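(* Let $\phi(z)=1+B_1z+B_2z^2+\cdots$ be a Ma-Minda function that is convex in $\mathbb{D}$, and suppose that the solution $\psi$ (with $\psi(0)=1$) of the differential equation $$\psi(z)+\frac{z\psi'(z)}{\psi(z)}=\phi(z)$$ is convex in $\mathbb{D}$. If $f\in\mathcal{C}(\phi)$, then the logarithmic coefficients $\gamma_m$ of $f$ satisfy $$2\sum_{m=1}^{\infty}|\gamma_m|r^m\le1\quad\text{for } 0\le r\le 1-\frac{1}{\exp(2/|B_1|)}.$$ The radius is sharp in the case when the function $f\in\mathcal{A}$ defined by $1+zf''(z)/f'(z)=\phi(z)$ is extremal for the logarithmic coefficient bounds, i.e. when its logarithmic coefficients satisfy $|\gamma_m|=|B_1|/(4m)$ for all $m\ge1$.
   Context: $\mathbb{D}=\{|z|<1\}$. $\mathcal{A}$ is the class of analytic functions $f(z)=z+\sum_{m\ge2}a_mz^m$ on $\mathbb{D}$. A Ma-Minda function is an analytic univalent function $\phi$ on $\mathbb{D}$ with $\Re\phi>0$, $\phi(0)=1$, $\phi'(0)>0$, and $\phi(\mathbb{D})$ symmetric about the real axis. A function is called convex in $\mathbb{D}$ if it is analytic and univalent in $\mathbb{D}$ with convex image. $u\prec v$ means $u=v\circ w$ for some analytic $w:\mathbb{D}\to\mathbb{D}$ with $w(0)=0$. $\mathcal{C}(\phi)=\{f\in\mathcal{A}: 1+zf''(z)/f'(z)\prec\phi(z)\}$. The logarithmic coefficients $\gamma_m$ of $f$ are defined by $\log(f(z)/z)=2\sum_{m=1}^{\infty}\gamma_mz^m$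 (branch vanishing at $0$). *)

theory Defs
  imports "HOL-Complex_Analysis.Complex_Analysis"
begin

abbreviation unit_disk :: "complex set" ("\<bbbD>") where
  "\<bbbD> \<equiv> ball 0 1"

definition class_A :: "(complex \<Rightarrow> complex) set" where
  "class_A = {f. f holomorphic_on \<bbbD> \<and> f 0 = 0 \<and> deriv f 0 = 1}"

definition ma_minda :: "(complex \<Rightarrow> complex) \<Rightarrow> bool" where
  "ma_minda \<phi> \<longleftrightarrow>
     \<phi> holomorphic_on \<bbbD> \<and> inj_on \<phi> \<bbbD> \<and>
     (\<forall>z\<in>\<bbbD>. Re (\<phi> z) > 0) \<and> \<phi> 0 = 1 \<and>
     deriv \<phi> 0 \<in> \<real> \<and> Re (deriv \<phi> 0) > 0 \<and>
     cnj ` (\<phi> ` \<bbbD>) = \<phi> ` \<bbbD>"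

definition convex_in_disk :: "(complex \<Rightarrow> complex) \<Rightarrow> bool" where
  "convex_in_disk g \<longleftrightarrow> g holomorphic_on \<bbbD> \<and> inj_on g \<bbbD> \<and> convex (g ` \<bbbD>)"

definition subordinate :: "(complex \<Rightarrow> complex) \<Rightarrow> (complex \<Rightarrow> complex) \<Rightarrow> bool"
    (infix "\<prec>" 50) where
  "u \<prec> v \<longleftrightarrow>
     (\<exists>w. w holomorphic_on \<bbbD> \<and> w ` \<bbbD> \<subseteq> \<bbbD> \<and> w 0 = 0 \<and> (\<forall>z\<in>\<bbbD>. u z = v (w z)))"

text \<open>Forming \<open>1 + z f''(z) / f'(z)\<close> on the disk presupposes that \<open>f'\<close> has no zeros there;
  since division by zero is total in HOL, this is stated explicitly.\<close>

definition class_C :: "(complex \<Rightarrow> complex) \<Rightarrow> (complex \<Rightarrow> complex) set" where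
  "class_C \<phi> = {f \<in> class_A. (\<forall>z\<in>\<bbbD>. deriv f z \<noteq> 0) \<and>
     (\<lambda>z. 1 + z * deriv (deriv f) z / deriv f z) \<prec> \<phi>}"

text \<open>\<open>L\<close> is the branch of \<open>log (f(z)/z)\<close> on the disk vanishing at \<open>0\<close>, and
  \<open>L(z) = 2 (\<gamma>\<^sub>1 z + \<gamma>\<^sub>2 z\<^sup>2 + \<dots>)\<close>; the unused entry \<open>\<gamma> 0\<close> is normalised to \<open>0\<close>.\<close>

definition is_log_coeffs :: "(complex \<Rightarrow> complex) \<Rightarrow> (nat \<Rightarrow> complex) \<Rightarrow> bool" where
  "is_log_coeffs f \<gamma> \<longleftrightarrow> \<gamma> 0 = 0 \<and>
     (\<exists>L. L holomorphic_on \<bbbD> \<and> L 0 = 0 \<and>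
        (\<forall>z\<in>\<bbbD> - {0}. exp (L z) = f z / z) \<and>
        (\<forall>z\<in>\<bbbD>. (\<lambda>m. 2 * \<gamma> m * z ^ m) sums L z))"

definition log_coeff :: "(complex \<Rightarrow> complex) \<Rightarrow> nat \<Rightarrow> complex" where
  "log_coeff f = (THE \<gamma>. is_log_coeffs f \<gamma>)"

lemma is_log_coeffs_unique:
  assumes "is_log_coeffs f \<gamma>" "is_log_coeffs f \<delta>"
  shows "\<gamma> = \<delta>"
proof (rule ccontr)
  assume "\<gamma> \<noteq> \<delta>"
  then obtain m where m: "\<gamma> m \<noteq> \<delta> m" by blast
  obtain L where L: "L holomorphic_on \<bbbD>" "L 0 = 0"
      "\<And>z. z \<in> \<bbbD> - {0} \<Longrightarrow> exp (L z) = f z / z"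
      "\<And>z. z \<in> \<bbbD> \<Longrightarrow> (\<lambda>m. 2 * \<gamma> m * z ^ m) sums L z"
    using assms(1) unfolding is_log_coeffs_def by blast
  obtain M where M: "M holomorphic_on \<bbbD>" "M 0 = 0"
      "\<And>z. z \<in> \<bbbD> - {0} \<Longrightarrow> exp (M z) = f z / z"
      "\<And>z. z \<in> \<bbbD> \<Longrightarrow> (\<lambda>m. 2 * \<delta> m * z ^ m) sums M z"
    using assms(2) unfolding is_log_coeffs_def by blast
  have "m > 0" using m assms by (cases m) (auto simp: is_log_coeffs_def)
  define d where "d = (\<lambda>z. L z - M z)"
  have "isCont d 0"
    unfolding d_def using L(1) M(1)
    by (intro continuous_intros)
       (auto intro!: continuous_on_interior[of \<bbbD>] holomorphic_on_imp_continuous_on)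
  then obtain e where e: "e > 0" "\<And>z. dist z 0 < e \<Longrightarrow> dist (d z) (d 0) < 2 * pi"
    unfolding continuous_at_eps_delta
    by (metis dist_norm pi_gt_zero zero_less_mult_iff zero_less_numeral)
  have near: "d z = 0" if "norm z < e" "norm z < 1" for z
  proof (cases "z = 0")
    case True
    then show ?thesis by (simp add: d_def L M)
  next
    case False
    have "norm (L z - M z) < 2 * pi"
      using e(2)[of z] that by (simp add: d_def L M)
    then have "\<bar>Im (L z) - Im (M z)\<bar> < 2 * pi"
      by (metis abs_Im_le_cmod minus_complex.sel(2) order_le_less_trans)
    then show ?thesis
      using exp_complex_eqI[of "L z" "M z"] L(3)[of z] M(3)[of z] False that
      by (simp add: d_def)
  qed
  have "(\<lambda>n. 2 * (\<gamma> n - \<delta> n) * (z - 0) ^ n) sums d z" if "norm (z - 0) < 1" for z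
    using sums_diff[OF L(4)[of z] M(4)[of z]] that by (simp add: d_def algebra_simps)
  moreover have "d 0 = 0" by (simp add: d_def L M)
  moreover have "2 * (\<gamma> m - \<delta> m) \<noteq> 0" using m by simp
  ultimately obtain s where s: "0 < s" "\<And>z. z \<in> cball 0 s - {0} \<Longrightarrow> d z \<noteq> 0"
    using powser_0_nonzero[where r = 1 and a = "\<lambda>n. 2 * (\<gamma> n - \<delta> n)" and \<xi> = 0 and f = d and m = m] \<open>m > 0\<close> by auto
  define t where "t = min s (min e 1) / 2"
  have "t > 0" "t < e" "t < 1" "t \<le> s"
    using s(1) e(1) unfolding t_def by linarith+
  then show False
    using s(2)[of "of_real t"] near[of "of_real t"] by simp
qed

lemma log_coeff_eqI: "is_log_coeffs f \<gamma> \<Longrightarrow> log_coeff f = \<gamma>"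
  unfolding log_coeff_def by (blast intro: the_equality is_log_coeffs_unique)

end

theory Submission
  imports Defs
begin

text \<open>
  For \<open>f\<close> in \<open>\<C>(\<phi>)\<close> the function \<open>p(z) = z f'(z) / f(z)\<close> satisfies \<open>p + z p'/p \<prec> \<phi>\<close>. If \<open>p\<close> left
  \<open>\<psi>(\<bbbD>)\<close>, Jack's lemma would give \<open>|z| < |\<zeta>| < 1\<close> and \<open>m \<ge> 1\<close> with \<open>p(z) = \<psi>(\<zeta>)\<close> and
  \<open>z p'(z) = m \<zeta> \<psi>'(\<zeta>)\<close>, so that \<open>p + z p'/p\<close> at \<open>z\<close> equals \<open>\<phi>(\<zeta>) + (m - 1) (\<phi>(\<zeta>) - \<psi>(\<zeta>))\<close>. As \<open>\<phi>\<close> is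
  convex and \<open>\<psi> \<prec> \<phi>\<close> (by the same argument), this lies on the outer side of the supporting line of
  \<open>\<phi>(|z| \<le> |\<zeta>|)\<close> at \<open>\<phi>(\<zeta>)\<close>, which is absurd. Hence \<open>p \<prec> \<psi>\<close>, and Rogosinski's coefficient bound for
  the convex \<open>\<psi>\<close>, whose derivative at \<open>0\<close> is \<open>B\<^sub>1/2\<close>, yields \<open>|\<gamma>\<^sub>m| \<le> |B\<^sub>1| / (4m)\<close>. The majorant sums
  to \<open>-(|B\<^sub>1|/2) ln (1 - r)\<close>, which is at most \<open>1\<close> exactly when \<open>r \<le> R\<close>.

  That \<open>f\<close> has no zero other than \<open>0\<close>, so that \<open>p\<close> is holomorphic, comes out of the same argument:
  on the disk up to the nearest other zero, \<open>p\<close> has positive real part, so \<open>|f|\<close> increases along rays.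
\<close>

section \<open>Schwarz's lemma on general disks and Jack's lemma\<close>

lemma DERIV_norm_square:
  fixes g :: "real \<Rightarrow> 'a::real_inner"
  assumes "(g has_vector_derivative g') (at t within S)"
  shows "((\<lambda>x. (norm (g x))\<^sup>2) has_real_derivative 2 * (g t \<bullet> g')) (at t within S)"
proof -
  have "(g has_derivative (\<lambda>x. x *\<^sub>R g')) (at t within S)"
    using assms by (simp add: has_vector_derivative_def)
  from has_derivative_inner[OF this this]
  show ?thesis
    unfolding power2_norm_eq_inner has_field_derivative_def
    by (rule has_derivative_eq_rhs) (auto simp: inner_commute algebra_simps)
qed

lemma Schwarz_ball:
  assumes W: "W holomorphic_on ball 0 s" "W 0 = 0"
    and le: "\<And>z. norm z < s \<Longrightarrow> norm (W z) \<le> M"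
    and z: "norm z < s"
  shows "norm (W z) \<le> M * norm z / s"
proof (cases "M = 0")
  case True
  then show ?thesis using le[OF z] by simp
next
  case False
  have s: "s > 0" using z by (meson norm_ge_zero order_le_less_trans)
  have M: "M > 0" using False le[of 0] s W(2) by auto
  \<comment> \<open>Schwarz's lemma needs values strictly below 1, while \<open>le\<close> only
    bounds by \<open>M\<close>; the factor \<open>c < 1\<close> creates the gap and tends to 1 at
    the end.\<close>
  have scaled: "c * norm (W z) \<le> M * norm z / s" if c: "0 < c" "c < 1" for c :: real
  proof -
    define h where "h = (\<lambda>\<xi>. of_real (c / M) * W (of_real s * \<xi>))"
    have in_ball: "norm (of_real s * \<xi>) < s" if "norm \<xi> < 1" for \<xi> :: complex
      using that s by (simp add: norm_mult)
    have "(\<lambda>\<xi>. W (of_real s * \<xi>)) holomorphic_on ball 0 1"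
      using in_ball
      by (intro holomorphic_on_compose_gen[OF _ W(1), unfolded o_def] holomorphic_intros) auto
    then have "h holomorphic_on ball 0 1"
      unfolding h_def by (intro holomorphic_intros)
    moreover have "h 0 = 0" using W by (simp add: h_def)
    moreover have "norm (h \<xi>) < 1" if "norm \<xi> < 1" for \<xi>
    proof -
      have "norm (h \<xi>) \<le> c / M * M"
        unfolding h_def norm_mult using c M le[OF in_ball[OF that]]
        by (intro mult_mono) (auto simp: norm_divide)
      then show ?thesis using c M by simp
    qed
    ultimately have "norm (h (z / of_real s)) \<le> norm (z / of_real s)"
      using s z by (intro Schwarz_Lemma(1)) (auto simp: norm_divide)
    then show ?thesis
      using s M c by (simp add: h_def norm_mult norm_divide field_simps)
  qed
  have "((\<lambda>c. c * norm (W z)) \<longlongrightarrow> 1 * norm (W z)) (at_left 1)"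
    by (intro tendsto_intros)
  moreover have "\<forall>\<^sub>F c::real in at_left 1. c * norm (W z) \<le> M * norm z / s"
    using eventually_at_left_real[of 0 1] by (rule eventually_mono) (auto intro: scaled)
  ultimately show ?thesis
    by (intro tendsto_upperbound[of "\<lambda>c. c * norm (W z)" _ "at_left (1::real)"]) auto
qed

text \<open>The function \<open>h(z) = W(z z\<^sub>0) / W(z\<^sub>0)\<close> satisfies \<open>|h(z)| \<le> |z|\<close> with equality at \<open>1\<close>;
  comparing derivatives at \<open>1\<close> along all directions pointing into the disk forces \<open>h'(1) - 1 \<ge> 0\<close>.\<close>

lemma Jack:
  assumes W: "W holomorphic_on S" "open S" "cball 0 (norm z0) \<subseteq> S" "W 0 = 0" "W z0 \<noteq> 0"
    and max: "\<And>z. norm z \<le> norm z0 \<Longrightarrow> norm (W z) \<le> norm (W z0)"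
  obtains m :: real where "m \<ge> 1" "z0 * deriv W z0 = of_real m * W z0"
proof -
  have z0: "z0 \<noteq> 0" using W by auto
  define h where "h = (\<lambda>z. W (z * z0) / W z0)"
  define c where "c = z0 * deriv W z0 / W z0"
  have h_le: "norm (h z) \<le> norm z" if "norm z < 1" for z
  proof -
    have "norm (W (z * z0)) \<le> norm (W z0) * norm (z * z0) / norm z0"
      using W that z0 max
      by (intro Schwarz_ball holomorphic_on_subset[OF W(1)]) (auto simp: norm_mult)
    then show ?thesis using W z0 by (simp add: h_def norm_divide norm_mult field_simps)
  qed
  have "(W has_field_derivative deriv W z0) (at (1 * z0))"
    using W by (auto intro: holomorphic_derivI)
  then have "((\<lambda>z. W (z * z0)) has_field_derivative deriv W z0 * z0) (at 1)"
    by (rule DERIV_chain2) (auto intro!: derivative_eq_intros)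
  then have "(h has_field_derivative deriv W z0 * z0 / W z0) (at 1)"
    unfolding h_def by (rule DERIV_cdivide)
  then have Dh: "(h has_field_derivative c) (at 1)" by (simp add: c_def mult.commute)
  have h1: "h 1 = 1" using W by (simp add: h_def)
  \<comment> \<open>Otherwise, for small \<open>t > 0\<close>, the path \<open>1 + t * d\<close>
    runs inside the disk while \<open>norm (h (l t))\<close> exceeds \<open>norm (l t)\<close>,
    against \<open>h_le\<close>.\<close>
  have key: "Re (c * d) \<le> Re d" if d: "Re d < 0" for d
  proof (rule ccontr)
    assume neg: "\<not> ?thesis"
    define l where "l = (\<lambda>t::real. 1 + of_real t * d)"
    have Dl: "(l has_vector_derivative d) (at 0)"
      unfolding l_def by (auto intro!: derivative_eq_intros)
    have l0: "l 0 = 1" by (simp add: l_def)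
    have D1: "((\<lambda>t. (norm (l t))\<^sup>2) has_real_derivative 2 * Re d) (at 0)"
      using DERIV_norm_square[OF Dl] by (simp add: l0 inner_complex_def)
    have "((h \<circ> l) has_vector_derivative d * c) (at 0)"
      using field_vector_diff_chain_at[OF Dl] Dh l0 by simp
    from DERIV_norm_square[OF this]
    have D2: "((\<lambda>t. (norm (h (l t)))\<^sup>2) has_real_derivative 2 * Re (c * d)) (at 0)"
      by (simp add: l0 h1 inner_complex_def mult.commute)
    obtain e1 where e1: "e1 > 0" "\<And>t. 0 < t \<Longrightarrow> t < e1 \<Longrightarrow> (norm (l t))\<^sup>2 < 1"
      using DERIV_neg_dec_right[OF D1] d l0 by auto
    obtain e2 where e2: "e2 > 0"
      "\<And>t. 0 < t \<Longrightarrow> t < e2 \<Longrightarrow> (norm (h (l t)))\<^sup>2 > (norm (l t))\<^sup>2"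
      using DERIV_pos_inc_right[OF DERIV_diff[OF D2 D1]] neg l0 h1 by auto
    define t where "t = min e1 e2 / 2"
    have t: "0 < t" "t < e1" "t < e2" using e1 e2 by (auto simp: t_def)
    have "norm (l t) < 1" using e1(2)[OF t(1,2)] by (simp add: power_less_one_iff)
    from h_le[OF this] have "(norm (h (l t)))\<^sup>2 \<le> (norm (l t))\<^sup>2" by (rule power_mono) simp
    with e2(2)[OF t(1,3)] show False by simp
  qed
  \<comment> \<open>The direction \<open>Complex (-1) (-k)\<close> bounds a linear function of
    \<open>k\<close> from above for all real \<open>k\<close>, which forces \<open>Im c = 0\<close>;
    then \<open>k = 0\<close> gives \<open>Re c \<ge> 1\<close>.\<close>
  have dir: "Im c * k \<le> Re c - 1" for k :: real
    using key[of "Complex (-1) (-k)"] by simp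
  have "Im c = 0"
  proof (rule ccontr)
    assume "Im c \<noteq> 0"
    then show False using dir[of "Re c / Im c"] by simp
  qed
  with dir[of 0] have "Re c \<ge> 1" "c = of_real (Re c)" by (auto simp: complex_eq_iff)
  moreover have "z0 * deriv W z0 = c * W z0" using W by (simp add: c_def)
  ultimately show thesis using that[of "Re c"] by metis
qed

section \<open>Maps that escape a univalent image\<close>

text \<open>Compactness supplies a first failure as the modulus grows. This locates both the first
  exit from an open image and the zero nearest to the origin.\<close>

lemma attains_min_norm:
  fixes p :: "'a::euclidean_space \<Rightarrow> 'b::topological_space"
  assumes cont: "continuous_on (cball 0 (norm z)) p" and T: "closed T" "p z \<in> T"
  obtains y where "p y \<in> T" "norm y \<le> norm z" "\<And>x. norm x < norm y \<Longrightarrow> p x \<notin> T"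
proof -
  define E where "E = cball 0 (norm z) \<inter> p -` T"
  have "closed E"
    unfolding E_def by (rule continuous_closed_preimage[OF cont closed_cball T(1)])
  moreover have "bounded E"
    unfolding E_def by (rule bounded_subset[OF bounded_cball Int_lower1])
  ultimately have "compact E" by (simp add: compact_eq_bounded_closed)
  moreover have "z \<in> E" using T by (simp add: E_def)
  moreover have "continuous_on E norm" by (intro continuous_intros)
  ultimately obtain y where y: "y \<in> E" "\<forall>x\<in>E. norm y \<le> norm x"
    using continuous_attains_inf[of E norm] by blast
  have "p x \<notin> T" if "norm x < norm y" for x
  proof
    assume "p x \<in> T"
    then have "x \<in> E" using y(1) that by (simp add: E_def)
    then show False using y(2) that by fastforce
  qed
  then show thesis using that[of y] y(1) by (simp add: E_def)
qed

text \<open>The hypothesis \<open>no\<close> rules out exactly what Jack's lemma yields for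
  \<open>W\<close>, the inverse of \<open>q\<close> applied after \<open>p\<close>. Jack's lemma is
  applied strictly inside the radius \<open>r\<close> of the first exit, so \<open>z\<close> and
  \<open>\<zeta>\<close> are both interior points.\<close>

lemma contained_in_univalent_image:
  assumes p: "p holomorphic_on ball 0 a" "a \<le> 1"
    and q: "q holomorphic_on \<bbbD>" "inj_on q \<bbbD>" "p 0 = q 0"
    and no: "\<And>z \<zeta> m::real. \<lbrakk>norm z < a; norm z < norm \<zeta>; norm \<zeta> < 1; m \<ge> 1; p z = q \<zeta>;
               z * deriv p z = of_real m * (\<zeta> * deriv q \<zeta>)\<rbrakk> \<Longrightarrow> False"
  shows "p ` ball 0 a \<subseteq> q ` \<bbbD>"
proof (rule ccontr)
  assume "\<not> ?thesis"
  then obtain z1 where z1: "norm z1 < a" "p z1 \<notin> q ` \<bbbD>"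
    by (auto simp: subset_iff image_iff Bex_def)
  obtain k where k: "k holomorphic_on q ` \<bbbD>"
      "\<And>z. z \<in> \<bbbD> \<Longrightarrow> deriv q z * deriv k (q z) = 1" "\<And>z. z \<in> \<bbbD> \<Longrightarrow> k (q z) = z"
    using holomorphic_has_inverse[OF q(1) open_ball q(2)] by blast
  have opq: "open (q ` \<bbbD>)" by (rule open_mapping_thm3[OF q(1) open_ball q(2)])
  have "continuous_on (cball 0 (norm z1)) p"
    using z1 by (intro holomorphic_on_imp_continuous_on holomorphic_on_subset[OF p(1)]) auto
  then obtain z2 where p2: "p z2 \<notin> q ` \<bbbD>" and z2: "norm z2 \<le> norm z1"
      "\<And>z. norm z < norm z2 \<Longrightarrow> p z \<notin> - (q ` \<bbbD>)"
    using attains_min_norm[of z1 p "- (q ` \<bbbD>)"] z1(2) opq by (auto simp: closed_Compl)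
  define r where "r = norm z2"
  have ra: "r < a" using z2(1) z1 by (simp add: r_def)
  have inq: "p z \<in> q ` \<bbbD>" if "norm z < r" for z
    using z2(2)[of z] that by (simp add: r_def)
  have r0: "r > 0" using p2 q(3) by (auto simp: r_def)
  define W where "W = (\<lambda>z. k (p z))"
  have holp: "p holomorphic_on ball 0 r" using p ra by (auto intro: holomorphic_on_subset)
  have Wprop: "W z \<in> \<bbbD> \<and> q (W z) = p z" if "norm z < r" for z
    using inq[OF that] k(3) unfolding W_def by (metis imageE)
  have holW: "W holomorphic_on ball 0 r"
    unfolding W_def using inq
    by (intro holomorphic_on_compose_gen[OF holp k(1), unfolded o_def]) auto
  have W0: "W 0 = 0" using k(3)[of 0] q(3) by (simp add: W_def)
  \<comment> \<open>If \<open>norm (W z)\<close> never exceeded \<open>r\<close>, then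
    \<open>p\<close> would map the closed disk of radius \<open>r\<close>, exit point
    \<open>z2\<close> included, into the compact image of \<open>cball 0 r\<close> under
    \<open>q\<close>.\<close>
  have "\<exists>z. norm z < r \<and> norm (W z) > r"
  proof (rule ccontr)
    assume "\<not> ?thesis"
    then have le: "norm (W z) \<le> r" if "norm z < r" for z using that by force
    have r1: "r < 1" using ra p by simp
    have "compact (q ` cball 0 r)"
      using r1 by (intro compact_continuous_image holomorphic_on_imp_continuous_on
          holomorphic_on_subset[OF q(1)]) auto
    then have cl: "closed (q ` cball 0 r)" by (rule compact_imp_closed)
    have "p ` closure (ball 0 r) \<subseteq> q ` cball 0 r"
    proof (rule image_closure_subset[OF _ cl])
      show "continuous_on (closure (ball 0 r)) p"
        using r0 ra by (intro holomorphic_on_imp_continuous_on holomorphic_on_subset[OF p(1)]) auto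
      show "p ` ball 0 r \<subseteq> q ` cball 0 r"
      proof safe
        fix z :: complex assume "z \<in> ball 0 r"
        then have "norm z < r" by simp
        from le[OF this] Wprop[OF this] show "p z \<in> q ` cball 0 r"
          by (intro image_eqI[of _ _ "W z"]) auto
      qed
    qed
    then have "p z2 \<in> q ` cball 0 r" using r0 by (auto simp: r_def)
    moreover have "q ` cball 0 r \<subseteq> q ` \<bbbD>" using r1 by (intro image_mono) auto
    ultimately show False using p2 by blast
  qed
  then obtain z3 where z3: "norm z3 < r" "norm (W z3) > r" by blast
  have "continuous_on (cball 0 (norm z3)) (\<lambda>z. norm (W z))"
    using z3 by (intro continuous_intros holomorphic_on_imp_continuous_on
        holomorphic_on_subset[OF holW]) auto
  \<comment> \<open>The maximum is at least the value at \<open>z3\<close>, so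
    \<open>norm (W z0) > r > norm z0\<close>: this is the strict inequality of moduli in
    \<open>no\<close>.\<close>
  from continuous_attains_sup[OF compact_cball _ this] obtain z0 where
    z0: "norm z0 \<le> norm z3" "\<And>z. norm z \<le> norm z3 \<Longrightarrow> norm (W z) \<le> norm (W z0)"
    by auto
  have big: "norm (W z0) > r" using z0(2)[of z3] z3 by simp
  have z0r: "norm z0 < r" using z0 z3 by simp
  obtain m :: real where m: "m \<ge> 1" "z0 * deriv W z0 = of_real m * W z0"
  proof (rule Jack[OF holW open_ball _ W0])
    show "W z0 \<noteq> 0" using big r0 by auto
  qed (use z0 z0r in auto)
  have "((\<lambda>z. q (W z)) has_field_derivative deriv q (W z0) * deriv W z0) (at z0)"
    using Wprop[OF z0r] z0r
    by (intro DERIV_chain2 holomorphic_derivI[OF q(1)] holomorphic_derivI[OF holW]) auto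
  then have "(p has_field_derivative deriv q (W z0) * deriv W z0) (at z0)"
    by (rule has_field_derivative_transform_within_open[of _ _ _ "ball 0 r"])
      (use Wprop z0r in auto)
  then have "z0 * deriv p z0 = of_real m * (W z0 * deriv q (W z0))"
    using m(2) by (simp add: DERIV_imp_deriv mult.left_commute)
  then show False
    using no[of z0 "W z0" m] Wprop[OF z0r] z0r big ra m by auto
qed

section \<open>Supporting lines of convex images, and univalent subordination\<close>

text \<open>\<open>\<zeta> \<phi>'(\<zeta>)\<close> is the outer normal to the image of the circle \<open>|z| = |\<zeta>|\<close>. Moving from \<open>\<phi>(\<zeta>)\<close>
  towards \<open>\<phi>(u)\<close> means following \<open>(1 - t) \<phi>(z) + t \<phi>(u z / \<zeta>)\<close>, a function subordinate to \<open>\<phi>\<close>,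
  so by the Schwarz lemma its preimage at \<open>z = \<zeta>\<close> does not leave the disk \<open>|z| \<le> |\<zeta>|\<close>.\<close>

lemma convex_support:
  assumes cv: "convex_in_disk \<phi>" and u: "norm u \<le> norm \<zeta>" and \<zeta>: "norm \<zeta> < 1"
  shows "(\<phi> u - \<phi> \<zeta>) \<bullet> (\<zeta> * deriv \<phi> \<zeta>) \<le> 0"
proof (cases "\<zeta> = 0")
  case True
  then show ?thesis using u by simp
next
  case False
  have hol: "\<phi> holomorphic_on \<bbbD>" and inj: "inj_on \<phi> \<bbbD>" and con: "convex (\<phi> ` \<bbbD>)"
    using cv by (auto simp: convex_in_disk_def)
  obtain k where k: "k holomorphic_on \<phi> ` \<bbbD>"
      "\<And>z. z \<in> \<bbbD> \<Longrightarrow> deriv \<phi> z * deriv k (\<phi> z) = 1" "\<And>z. z \<in> \<bbbD> \<Longrightarrow> k (\<phi> z) = z"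
    using holomorphic_has_inverse[OF hol open_ball inj] by blast
  have op: "open (\<phi> ` \<bbbD>)" by (rule open_mapping_thm3[OF hol open_ball inj])
  define D where "D = deriv k (\<phi> \<zeta>) * (\<phi> u - \<phi> \<zeta>)"
  define V where "V = (\<lambda>t::real. k (\<phi> \<zeta> + of_real t * (\<phi> u - \<phi> \<zeta>)))"
  have V0: "V 0 = \<zeta>" using k(3)[of \<zeta>] \<zeta> by (simp add: V_def)
  have "((\<lambda>t::real. \<phi> \<zeta> + of_real t * (\<phi> u - \<phi> \<zeta>)) has_vector_derivative (\<phi> u - \<phi> \<zeta>)) (at 0)"
    by (auto intro!: derivative_eq_intros)
  moreover have "(k has_field_derivative deriv k (\<phi> \<zeta>)) (at (\<phi> \<zeta> + of_real 0 * (\<phi> u - \<phi> \<zeta>)))"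
    using \<zeta> by (auto intro!: holomorphic_derivI[OF k(1) op])
  ultimately have "(V has_vector_derivative D) (at 0)"
    using field_vector_diff_chain_at unfolding V_def D_def o_def by (fastforce simp: mult.commute)
  from DERIV_norm_square[OF this]
  have DV: "((\<lambda>t. (norm (V t))\<^sup>2) has_real_derivative 2 * (\<zeta> \<bullet> D)) (at 0)" by (simp add: V0)
  have V_le: "norm (V t) \<le> norm \<zeta>" if t: "0 < t" "t < 1" for t
  proof -
    define G where "G = (\<lambda>z. of_real (1 - t) * \<phi> z + of_real t * \<phi> (u / \<zeta> * z))"
    have inD: "norm (u / \<zeta> * z) < 1" if "norm z < 1" for z
    proof -
      have "norm (u / \<zeta> * z) \<le> 1 * norm z"
        unfolding norm_mult using u False by (intro mult_right_mono) (auto simp: norm_divide field_simps)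
      then show ?thesis using that by simp
    qed
    have "(\<lambda>z. \<phi> (u / \<zeta> * z)) holomorphic_on \<bbbD>"
      using inD by (intro holomorphic_on_compose_gen[OF _ hol, unfolded o_def] holomorphic_intros) auto
    then have holG: "G holomorphic_on \<bbbD>"
      unfolding G_def by (intro holomorphic_intros hol)
    have Gin: "G z \<in> \<phi> ` \<bbbD>" if "norm z < 1" for z
      using convexD[OF con, of "\<phi> z" "\<phi> (u / \<zeta> * z)" "1 - t" t] inD[OF that] that t
      by (auto simp: G_def scaleR_conv_of_real)
    have "norm (k (G \<zeta>)) \<le> norm \<zeta>"
    proof (rule Schwarz_Lemma(1)[OF _ _ _ \<zeta>, of "\<lambda>z. k (G z)"])
      show "(\<lambda>z. k (G z)) holomorphic_on \<bbbD>"
        using Gin by (intro holomorphic_on_compose_gen[OF holG k(1), unfolded o_def]) auto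
      show "k (G 0) = 0" using k(3)[of 0] by (simp add: G_def flip: distrib_right)
      show "norm (k (G z)) < 1" if "norm z < 1" for z
        using Gin[OF that] k(3) by fastforce
    qed
    moreover have "G \<zeta> = \<phi> \<zeta> + of_real t * (\<phi> u - \<phi> \<zeta>)"
      using False by (simp add: G_def algebra_simps)
    ultimately show ?thesis by (simp add: V_def)
  qed
  have "\<zeta> \<bullet> D \<le> 0"
  proof (rule ccontr)
    assume "\<not> ?thesis"
    then obtain d where d: "d > 0" "\<And>t. 0 < t \<Longrightarrow> t < d \<Longrightarrow> (norm (V t))\<^sup>2 > (norm \<zeta>)\<^sup>2"
      using DERIV_pos_inc_right[OF DV] V0 by auto
    have "norm (V (min d 1 / 2)) > norm \<zeta>"
      using d(1) by (intro power2_less_imp_less[OF d(2)]) (linarith | simp)+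
    moreover have "0 < min d 1 / 2" "min d 1 / 2 < 1" using d(1) by linarith+
    ultimately show False using V_le[of "min d 1 / 2"] by simp
  qed
  \<comment> \<open>Multiplication by \<open>deriv \<phi> \<zeta>\<close> is conformal: it scales
    inner products by its squared modulus and so carries the sign of
    \<open>\<zeta> \<bullet> D\<close> over to the image.\<close>
  moreover have "\<phi> u - \<phi> \<zeta> = deriv \<phi> \<zeta> * D"
    using k(2)[of \<zeta>] \<zeta> by (simp add: D_def flip: mult.assoc)
  then have "(\<phi> u - \<phi> \<zeta>) \<bullet> (\<zeta> * deriv \<phi> \<zeta>) = (norm (deriv \<phi> \<zeta>))\<^sup>2 * (\<zeta> \<bullet> D)"
    by (simp only: cmod_power2) (simp add: inner_complex_def algebra_simps power2_eq_square)
  ultimately show ?thesis by (simp add: mult_nonneg_nonpos)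
qed

text \<open>The image of \<open>ball 0 (norm \<zeta>)\<close> is open and lies in the closed
  half-plane of \<open>convex_support\<close>. None of its points is on the bounding line, since a
  small push along the outer normal would cross it.\<close>

lemma convex_support_strict:
  assumes cv: "convex_in_disk \<phi>" and u: "norm u < norm \<zeta>" and \<zeta>: "norm \<zeta> < 1"
  shows "(\<phi> u - \<phi> \<zeta>) \<bullet> (\<zeta> * deriv \<phi> \<zeta>) < 0"
proof -
  have hol: "\<phi> holomorphic_on \<bbbD>" and inj: "inj_on \<phi> \<bbbD>"
    using cv by (auto simp: convex_in_disk_def)
  define n where "n = \<zeta> * deriv \<phi> \<zeta>"
  have n: "n \<noteq> 0"
    using holomorphic_injective_imp_regular[OF hol open_ball inj, of \<zeta>] \<zeta> u by (auto simp: n_def)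
  have "open (\<phi> ` ball 0 (norm \<zeta>))"
    using \<zeta> by (intro open_mapping_thm3 holomorphic_on_subset[OF hol] inj_on_subset[OF inj]) auto
  then obtain e where e: "e > 0" "ball (\<phi> u) e \<subseteq> \<phi> ` ball 0 (norm \<zeta>)"
    using u by (auto elim!: openE simp del: subset_iff)
  define y where "y = \<phi> u + of_real (e / (2 * norm n)) * n"
  have "y \<in> ball (\<phi> u) e" using e n by (simp add: y_def dist_norm norm_mult norm_divide)
  then obtain v where v: "norm v < norm \<zeta>" "y = \<phi> v" using e by auto
  have "(y - \<phi> \<zeta>) \<bullet> n \<le> 0"
    using convex_support[OF cv, of v \<zeta>] v \<zeta> by (simp add: n_def)
  moreover have "(y - \<phi> \<zeta>) \<bullet> n = (\<phi> u - \<phi> \<zeta>) \<bullet> n + e / (2 * norm n) * (norm n)\<^sup>2"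
    unfolding y_def power2_norm_eq_inner scaleR_conv_of_real[symmetric]
    by (simp add: inner_diff_left inner_add_left)
  moreover have "e / (2 * norm n) * (norm n)\<^sup>2 > 0" using e n by simp
  ultimately show ?thesis by (simp add: n_def)
qed

text \<open>Both claims are Schwarz's lemma for the inverse of \<open>q\<close> applied after
  \<open>p\<close>.\<close>

lemma univalent_subordination:
  assumes p: "p holomorphic_on \<bbbD>" and q: "q holomorphic_on \<bbbD>" "inj_on q \<bbbD>"
    and "p 0 = q 0" and sub: "p ` \<bbbD> \<subseteq> q ` \<bbbD>"
  shows "norm z < 1 \<Longrightarrow> \<exists>u. norm u \<le> norm z \<and> p z = q u"
    and "norm (deriv p 0) \<le> norm (deriv q 0)"
proof -
  obtain k where k: "k holomorphic_on q ` \<bbbD>"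
      "\<And>z. z \<in> \<bbbD> \<Longrightarrow> deriv q z * deriv k (q z) = 1" "\<And>z. z \<in> \<bbbD> \<Longrightarrow> k (q z) = z"
    using holomorphic_has_inverse[OF q(1) open_ball q(2)] by blast
  have op: "open (q ` \<bbbD>)" by (rule open_mapping_thm3[OF q(1) open_ball q(2)])
  define W where "W = (\<lambda>z. k (p z))"
  have Wprop: "norm (W z) < 1 \<and> q (W z) = p z" if "norm z < 1" for z
    using sub k(3) that unfolding W_def by (fastforce simp: subset_iff image_iff)
  have holW: "W holomorphic_on \<bbbD>"
    unfolding W_def using sub
    by (intro holomorphic_on_compose_gen[OF p k(1), unfolded o_def]) auto
  have W0: "W 0 = 0" using k(3)[of 0] \<open>p 0 = q 0\<close> by (simp add: W_def)
  show "\<exists>u. norm u \<le> norm z \<and> p z = q u" if "norm z < 1"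
    using Schwarz_Lemma(1)[OF holW W0 _ that] Wprop that by metis
  have "(k has_field_derivative deriv k (q 0)) (at (p 0))"
    using \<open>p 0 = q 0\<close> by (auto intro: holomorphic_derivI[OF k(1) op])
  moreover have "(p has_field_derivative deriv p 0) (at 0)"
    by (rule holomorphic_derivI[OF p]) auto
  ultimately have "(W has_field_derivative deriv k (q 0) * deriv p 0) (at 0)"
    unfolding W_def by (rule DERIV_chain2)
  then have "deriv W 0 = deriv k (q 0) * deriv p 0" by (rule DERIV_imp_deriv)
  then have "deriv p 0 = deriv q 0 * deriv W 0"
    using k(2)[of 0] by (simp flip: mult.assoc)
  moreover have "norm (deriv W 0) \<le> 1"
    using Schwarz_Lemma(2)[OF holW W0, of 0] Wprop by simp
  ultimately show "norm (deriv p 0) \<le> norm (deriv q 0)"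
    by (simp add: norm_mult mult_left_le)
qed

section \<open>Briot-Bouquet differential subordination\<close>

text \<open>At a contact point \<open>\<psi> z = \<phi> \<zeta>\<close> the equation gives
  \<open>\<phi> z = \<phi> \<zeta> + m * (n / \<phi> \<zeta>)\<close> with \<open>n\<close> the
  outer normal. Since \<open>Re (\<phi> \<zeta>) > 0\<close>, this shift does not point inwards,
  whereas \<open>norm z < norm \<zeta>\<close> puts \<open>\<phi> z\<close> strictly inside the
  supporting line.\<close>

lemma briot_bouquet_solution_subordinate:
  assumes \<phi>: "convex_in_disk \<phi>" "\<phi> 0 = 1" "\<And>z. norm z < 1 \<Longrightarrow> Re (\<phi> z) > 0"
    and \<psi>: "\<psi> holomorphic_on \<bbbD>" "\<psi> 0 = 1"
    and eq: "\<And>z. norm z < 1 \<Longrightarrow> \<psi> z + z * deriv \<psi> z / \<psi> z = \<phi> z"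
    and z: "norm z < 1"
  shows "\<exists>u. norm u \<le> norm z \<and> \<psi> z = \<phi> u"
proof -
  have hol: "\<phi> holomorphic_on \<bbbD>" and inj: "inj_on \<phi> \<bbbD>"
    using \<phi> by (auto simp: convex_in_disk_def)
  have "\<psi> ` ball 0 1 \<subseteq> \<phi> ` \<bbbD>"
  proof (rule contained_in_univalent_image[OF \<psi>(1) order_refl hol inj])
    fix z \<zeta> :: complex and m :: real
    assume *: "norm z < norm \<zeta>" "norm \<zeta> < 1" "m \<ge> 1" "\<psi> z = \<phi> \<zeta>"
      "z * deriv \<psi> z = of_real m * (\<zeta> * deriv \<phi> \<zeta>)"
    define n where "n = \<zeta> * deriv \<phi> \<zeta>"
    have "(\<phi> z - \<phi> \<zeta>) \<bullet> n < 0"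
      using convex_support_strict[OF \<phi>(1) *(1,2)] by (simp add: n_def)
    moreover have "\<phi> z = \<phi> \<zeta> + of_real m * (n / \<phi> \<zeta>)"
      using eq[of z] * by (simp add: n_def)
    then have "\<phi> z - \<phi> \<zeta> = of_real m * (n / \<phi> \<zeta>)" by simp
    moreover have "(of_real m * (n / \<phi> \<zeta>)) \<bullet> n = m * ((n / \<phi> \<zeta>) \<bullet> n)"
      unfolding scaleR_conv_of_real[symmetric] by (rule inner_scaleR_left)
    moreover have "n / \<phi> \<zeta> = (1 / (norm (\<phi> \<zeta>))\<^sup>2) *\<^sub>R (n * cnj (\<phi> \<zeta>))"
      by (simp add: complex_div_cnj[of n] scaleR_conv_of_real)
    moreover have "(n * cnj (\<phi> \<zeta>)) \<bullet> n = (norm n)\<^sup>2 * Re (\<phi> \<zeta>)"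
      unfolding cmod_power2 by (simp add: inner_complex_def power2_eq_square algebra_simps)
    moreover have "\<phi> \<zeta> \<noteq> 0" using \<phi>(3)[OF *(2)] by auto
    ultimately have "m * ((norm n)\<^sup>2 * Re (\<phi> \<zeta>) / (norm (\<phi> \<zeta>))\<^sup>2) < 0" by simp
    moreover have "m * ((norm n)\<^sup>2 * Re (\<phi> \<zeta>) / (norm (\<phi> \<zeta>))\<^sup>2) \<ge> 0"
      using \<phi>(3)[OF *(2)] *(3) by simp
    ultimately show False
      by simp
  qed (use \<phi> \<psi> in auto)
  then show ?thesis
    using univalent_subordination(1)[OF \<psi>(1) hol inj] \<phi> \<psi> z by simp
qed

text \<open>The radius \<open>a\<close> may be below 1 because z f'(z) / f(z) is at first known to
  be holomorphic only up to the nearest zero of f(z) / z.\<close>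

lemma briot_bouquet_best_dominant:
  assumes \<phi>: "convex_in_disk \<phi>" "\<phi> 0 = 1" "\<And>z. norm z < 1 \<Longrightarrow> Re (\<phi> z) > 0"
    and \<psi>: "\<psi> holomorphic_on \<bbbD>" "inj_on \<psi> \<bbbD>" "\<psi> 0 = 1"
    and eq: "\<And>z. norm z < 1 \<Longrightarrow> \<psi> z + z * deriv \<psi> z / \<psi> z = \<phi> z"
    and p: "p holomorphic_on ball 0 a" "a \<le> 1" "p 0 = 1"
    and sub: "\<And>z. norm z < a \<Longrightarrow> \<exists>u. norm u \<le> norm z \<and> p z + z * deriv p z / p z = \<phi> u"
  shows "p ` ball 0 a \<subseteq> \<psi> ` \<bbbD>"
proof (rule contained_in_univalent_image[OF p(1,2) \<psi>(1,2)])
  fix z \<zeta> :: complex and m :: real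
  assume *: "norm z < a" "norm z < norm \<zeta>" "norm \<zeta> < 1" "m \<ge> 1" "p z = \<psi> \<zeta>"
    "z * deriv p z = of_real m * (\<zeta> * deriv \<psi> \<zeta>)"
  define n where "n = \<zeta> * deriv \<phi> \<zeta>"
  obtain u where u: "norm u \<le> norm z" "p z + z * deriv p z / p z = \<phi> u"
    using sub *(1) by blast
  have "\<phi> u = \<psi> \<zeta> + of_real m * (\<zeta> * deriv \<psi> \<zeta> / \<psi> \<zeta>)"
    using u(2) * by simp
  also have "\<zeta> * deriv \<psi> \<zeta> / \<psi> \<zeta> = \<phi> \<zeta> - \<psi> \<zeta>"
    using eq[OF *(3)] by (simp add: algebra_simps)
  finally have "\<phi> u - \<phi> \<zeta> = (m - 1) *\<^sub>R (\<phi> \<zeta> - \<psi> \<zeta>)"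
    by (simp add: scaleR_conv_of_real algebra_simps)
  moreover have "(\<phi> u - \<phi> \<zeta>) \<bullet> n < 0"
    using convex_support_strict[OF \<phi>(1) _ *(3)] u * by (simp add: n_def)
  \<comment> \<open>Since \<open>\<psi> \<zeta>\<close> is a value of \<open>\<phi>\<close> on the
    closed disk of radius \<open>norm \<zeta>\<close>, the vector
    \<open>\<phi> \<zeta> - \<psi> \<zeta>\<close> has no inward component; nor does its multiple by
    \<open>m - 1 \<ge> 0\<close>.\<close>
  moreover obtain v where v: "norm v \<le> norm \<zeta>" "\<psi> \<zeta> = \<phi> v"
    using briot_bouquet_solution_subordinate[OF \<phi> \<psi>(1,3) eq *(3)] by blast
  have "(\<phi> v - \<phi> \<zeta>) \<bullet> n \<le> 0"
    using convex_support[OF \<phi>(1) v(1) *(3)] by (simp add: n_def)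
  then have "(\<phi> \<zeta> - \<psi> \<zeta>) \<bullet> n \<ge> 0" using v by (simp add: inner_diff_left)
  ultimately show False
    using *(4) by (simp add: mult_less_0_iff)
qed (use \<psi> p in auto)

section \<open>The quotients f(z) / z and z f'(z) / f(z)\<close>

text \<open>The positivity hypothesis says that \<open>|f|\<close> increases along the ray from \<open>0\<close> to \<open>z\<close>.\<close>

lemma starlike_nonzero:
  assumes f: "f holomorphic_on \<bbbD>" and z: "z \<noteq> 0" "norm z < 1"
    and nz: "\<And>y. y \<noteq> 0 \<Longrightarrow> norm y < norm z \<Longrightarrow> f y \<noteq> 0"
    and pos: "\<And>y. y \<noteq> 0 \<Longrightarrow> norm y < norm z \<Longrightarrow> Re (y * deriv f y / f y) > 0"
  shows "f z \<noteq> 0"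
proof -
  define G where "G = (\<lambda>t::real. f (of_real t * z))"
  have inD: "norm (of_real t * z) < 1" if "\<bar>t\<bar> \<le> 1" for t
    using that z by (auto simp: norm_mult intro: le_less_trans[OF mult_left_le_one_le])
  have DG: "(G has_vector_derivative z * deriv f (of_real t * z)) (at t)" if "\<bar>t\<bar> \<le> 1" for t
  proof -
    have "((\<lambda>t. of_real t * z) has_vector_derivative z) (at t)"
      by (auto intro!: derivative_eq_intros)
    moreover have "(f has_field_derivative deriv f (of_real t * z)) (at (of_real t * z))"
      using inD[OF that] by (auto intro!: holomorphic_derivI[OF f])
    ultimately show ?thesis
      using field_vector_diff_chain_at unfolding G_def o_def by fastforce
  qed
  \<comment> \<open>Starting at \<open>1/2\<close> avoids the origin, where \<open>nz\<close> and
    \<open>pos\<close> say nothing; a strict increase from any nonnegative value already makes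
    \<open>G 1\<close> nonzero.\<close>
  have "(norm (G (1/2)))\<^sup>2 < (norm (G 1))\<^sup>2"
  proof (rule DERIV_pos_imp_increasing_open[of "1/2" 1 "\<lambda>t. (norm (G t))\<^sup>2"])
    fix t :: real assume t: "1/2 < t" "t < 1"
    define y where "y = of_real t * z"
    have y: "y \<noteq> 0" "norm y < norm z" using t z by (auto simp: y_def norm_mult)
    define P where "P = y * deriv f y / f y"
    have "z * deriv f y = (1 / t) *\<^sub>R (f y * P)"
      using y t nz[OF y] by (simp add: y_def P_def scaleR_conv_of_real)
    moreover have "f y \<bullet> (f y * P) = (norm (f y))\<^sup>2 * Re P"
      unfolding cmod_power2 by (simp add: inner_complex_def power2_eq_square algebra_simps)
    ultimately have "G t \<bullet> (z * deriv f y) = (norm (f y))\<^sup>2 * Re P / t"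
      by (simp add: G_def y_def)
    then have "G t \<bullet> (z * deriv f y) > 0"
      using pos[OF y] nz[OF y] t by (simp add: P_def)
    then show "\<exists>d. ((\<lambda>t. (norm (G t))\<^sup>2) has_real_derivative d) (at t) \<and> 0 < d"
      using DERIV_norm_square[OF DG[of t]] t by (force simp: y_def)
  next
    show "continuous_on {1/2..1} (\<lambda>t. (norm (G t))\<^sup>2)"
      by (intro continuous_intros continuous_at_imp_continuous_on ballI
          has_vector_derivative_continuous[OF DG]) auto
  qed simp
  then show ?thesis by (auto simp: G_def)
qed

text \<open>Here \<open>g\<close> is f(z) / z with the singularity at 0 removed, so
  \<open>deriv f z / g z\<close> is z f'(z) / f(z) with its correct value at 0.\<close>

lemma class_C_imp_quotient_subordinate:
  assumes \<phi>: "convex_in_disk \<phi>" "\<phi> 0 = 1" "\<And>z. norm z < 1 \<Longrightarrow> Re (\<phi> z) > 0"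
    and \<psi>: "\<psi> holomorphic_on \<bbbD>" "inj_on \<psi> \<bbbD>" "\<psi> 0 = 1"
    and eq: "\<And>z. norm z < 1 \<Longrightarrow> \<psi> z + z * deriv \<psi> z / \<psi> z = \<phi> z"
    and f: "f \<in> class_C \<phi>"
  obtains g where "g holomorphic_on \<bbbD>" "g 0 = 1" "\<And>z. norm z < 1 \<Longrightarrow> g z \<noteq> 0"
    "\<And>z. norm z < 1 \<Longrightarrow> f z = z * g z" "(\<lambda>z. deriv f z / g z) ` \<bbbD> \<subseteq> \<psi> ` \<bbbD>"
proof -
  have holf: "f holomorphic_on \<bbbD>" and f0: "f 0 = 0" "deriv f 0 = 1"
    and f'nz: "\<And>z. norm z < 1 \<Longrightarrow> deriv f z \<noteq> 0"
    using f by (auto simp: class_C_def class_A_def)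
  obtain w where w: "w holomorphic_on \<bbbD>" "w ` \<bbbD> \<subseteq> \<bbbD>" "w 0 = 0"
      "\<And>z. norm z < 1 \<Longrightarrow> 1 + z * deriv (deriv f) z / deriv f z = \<phi> (w z)"
    using f by (auto simp: class_C_def subordinate_def)
  have w_le: "norm (w z) \<le> norm z" if "norm z < 1" for z
    using w(1-3) that by (intro Schwarz_Lemma(1)) (auto simp: image_subset_iff)
  obtain g where g: "g holomorphic_on \<bbbD>" "\<And>z. norm z < 1 \<Longrightarrow> f z = z * g z"
      "deriv f 0 = g 0"
    using Schwarz3[OF holf f0(1)] by metis
  have g0: "g 0 = 1" using g f0 by simp
  define p where "p = (\<lambda>z. deriv f z / g z)"
  have Df: "deriv f z = g z + z * deriv g z" if "norm z < 1" for z
  proof (rule DERIV_imp_deriv)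
    have "((\<lambda>z. z * g z) has_field_derivative g z + z * deriv g z) (at z)"
      using that by (auto intro!: derivative_eq_intros holomorphic_derivI[OF g(1)])
    then show "(f has_field_derivative g z + z * deriv g z) (at z)"
      by (rule has_field_derivative_transform_within_open[of _ _ _ \<bbbD>]) (use that g in auto)
  qed
  \<comment> \<open>Logarithmic differentiation of z f'(z) / f(z) turns 1 + z f''(z) / f'(z) into
    \<open>p z + z * deriv p z / p z\<close>.\<close>
  have p_eq: "p z + z * deriv p z / p z = \<phi> (w z)" if z: "norm z < 1" "g z \<noteq> 0" for z
  proof -
    have "(p has_field_derivative
        (deriv (deriv f) z * g z - deriv f z * deriv g z) / (g z * g z)) (at z)"
      unfolding p_def using z
      by (intro DERIV_divide holomorphic_derivI[OF g(1)]
          holomorphic_derivI[OF holomorphic_deriv[OF holf]]) auto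
    then have Dp: "deriv p z = (deriv (deriv f) z * g z - deriv f z * deriv g z) / (g z * g z)"
      by (rule DERIV_imp_deriv)
    have "z * deriv p z / p z = z * deriv (deriv f) z / deriv f z - z * deriv g z / g z"
      using z f'nz[OF z(1)] unfolding Dp by (simp add: p_def field_simps)
    moreover have "p z = 1 + z * deriv g z / g z"
      using z unfolding p_def Df[OF z(1)] by (simp add: field_simps)
    ultimately show ?thesis using w(4)[OF z(1)] by simp
  qed
  \<comment> \<open>Used twice: with \<open>a\<close> the modulus of a hypothetical nearest zero of
    \<open>g\<close>, then with \<open>a = 1\<close> once \<open>g\<close> is zero-free.\<close>
  have p_sub: "p ` ball 0 a \<subseteq> \<psi> ` \<bbbD>"
    if a: "a \<le> 1" and nz: "\<And>z. norm z < a \<Longrightarrow> g z \<noteq> 0" for a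
  proof (rule briot_bouquet_best_dominant[OF \<phi> \<psi> eq _ a])
    show "p holomorphic_on ball 0 a"
      unfolding p_def using a nz
      by (intro holomorphic_intros holomorphic_on_subset[OF holomorphic_deriv[OF holf]]
          holomorphic_on_subset[OF g(1)]) auto
    show "p 0 = 1" using f0 g0 by (simp add: p_def)
    show "\<exists>u. norm u \<le> norm z \<and> p z + z * deriv p z / p z = \<phi> u" if "norm z < a" for z
      using p_eq[of z] w_le[of z] nz[OF that] that a by force
  qed
  have gnz: "g z \<noteq> 0" if "norm z < 1" for z
  proof
    assume gz: "g z = 0"
    have "continuous_on (cball 0 (norm z)) g"
      using that by (intro holomorphic_on_imp_continuous_on holomorphic_on_subset[OF g(1)]) auto
    then obtain y where y: "g y \<in> {0}" "norm y \<le> norm z" "\<And>x. norm x < norm y \<Longrightarrow> g x \<notin> {0}"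
      using attains_min_norm[of z g "{0}"] gz by auto
    have y1: "norm y < 1" "y \<noteq> 0" "g y = 0" using y that g0 by auto
    have nz: "g x \<noteq> 0" if "norm x < norm y" for x
      using y(3)[OF that] by simp
    have "f y \<noteq> 0"
    proof (rule starlike_nonzero[OF holf y1(2,1)])
      fix x :: complex assume x: "x \<noteq> 0" "norm x < norm y"
      then show "f x \<noteq> 0" using g(2)[of x] nz[of x] y1 by auto
      have "p ` ball 0 (norm y) \<subseteq> \<psi> ` \<bbbD>" using y1 nz by (intro p_sub) auto
      then have "p x \<in> \<psi> ` \<bbbD>" using x by (simp add: image_subset_iff)
      then obtain v where v: "norm v < 1" "p x = \<psi> v" by auto
      obtain u where "norm u \<le> norm v" "\<psi> v = \<phi> u"
        using briot_bouquet_solution_subordinate[OF \<phi> \<psi>(1,3) eq v(1)] by blast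
      then have "Re (p x) > 0" using v \<phi>(3)[of u] by simp
      moreover have "x * deriv f x / f x = p x"
        using x g(2)[of x] y1 by (simp add: p_def)
      ultimately show "Re (x * deriv f x / f x) > 0" by simp
    qed
    then show False using g(2)[of y] y1 by simp
  qed
  show thesis
    using that[OF g(1) g0 gnz g(2)] p_sub[of 1] gnz by (simp add: p_def)
qed

section \<open>Rogosinski's coefficient bound\<close>

lemma power_series_deriv_0:
  fixes c :: "nat \<Rightarrow> complex"
  assumes "r > 0" and sums: "\<And>z. norm z < r \<Longrightarrow> (\<lambda>n. c n * z ^ n) sums f z"
  shows "deriv f 0 = c 1"
proof (rule DERIV_imp_deriv)
  have "((\<lambda>z. \<Sum>n. c n * z ^ n) has_field_derivative (\<Sum>n. diffs c n * 0 ^ n)) (at 0)"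
    using assms by (intro termdiffs_strong'[of r]) (auto intro: sums_summable)
  then have "((\<lambda>z. \<Sum>n. c n * z ^ n) has_field_derivative c 1) (at 0)"
    by (simp add: diffs_def)
  then show "(f has_field_derivative c 1) (at 0)"
    by (rule has_field_derivative_transform_within_open[of _ _ _ "ball 0 r"])
      (use assms in \<open>auto simp: sums_iff\<close>)
qed

lemma convex_average:
  fixes S :: "'a::real_vector set"
  assumes "convex S" "m \<ge> 1" "\<And>j. j < m \<Longrightarrow> x j \<in> S"
  shows "(1 / real m) *\<^sub>R (\<Sum>j<m. x j) \<in> S"
  unfolding scaleR_sum_right using assms by (intro convex_sum) auto

text \<open>Averaging over the \<open>m\<close>-th roots of unity turns coefficient \<open>m\<close> into coefficient \<open>1\<close>.\<close>

lemma Rogosinski: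
  assumes q: "convex_in_disk q" and "p 0 = q 0" and sub: "p ` \<bbbD> \<subseteq> q ` \<bbbD>"
    and sums: "\<And>z. norm z < 1 \<Longrightarrow> (\<lambda>n. c n * z ^ n) sums p z" and m: "m \<ge> 1"
  shows "norm (c m) \<le> norm (deriv q 0)"
proof -
  define \<omega> where "\<omega> = exp (2 * of_real pi * \<i> / of_nat m)"
  define F where "F = (\<lambda>z. \<Sum>k. c (m * k) * z ^ k)"
  have norm\<omega>: "norm (\<omega> ^ j * y) = norm y" for j y
    by (simp add: norm_mult norm_power \<omega>_def norm_exp_eq_Re)
  have \<omega>_eq_1: "\<omega> ^ n = 1 \<longleftrightarrow> m dvd n" for n
    using complex_root_unity_eq_1[of m n] m by (simp add: \<omega>_def exp_of_nat_mult[symmetric] mult_ac)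
  have root_sum: "(\<Sum>j<m. (\<omega> ^ j) ^ n) = (if m dvd n then of_nat m else 0)" for n
  proof -
    have "(\<Sum>j<m. (\<omega> ^ j) ^ n) = (\<Sum>j<m. (\<omega> ^ n) ^ j)"
      by (simp add: mult.commute flip: power_mult)
    moreover have "(\<omega> ^ n) ^ m = 1" using \<omega>_eq_1[of "n * m"] by (simp add: power_mult)
    ultimately show ?thesis using \<omega>_eq_1[of n]
      by (cases "m dvd n") (auto simp: geometric_sum)
  qed
  have F: "(\<lambda>k. c (m * k) * z ^ k) sums F z \<and> F z \<in> q ` \<bbbD>" if z: "norm z < 1" for z
  proof -
    \<comment> \<open>The points \<open>\<omega> ^ j * y\<close> are the \<open>m\<close>-th roots
      of \<open>z\<close>. The mean \<open>A\<close> of \<open>p\<close> over them equals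
      \<open>F z\<close>, and convexity keeps it in the image of \<open>q\<close>.\<close>
    obtain y where y: "y ^ m = z"
    proof (cases "z = 0")
      case True
      then show thesis using m by (intro that[of 0]) simp
    next
      case False
      have "exp (Ln z / of_nat m) ^ m = z"
        using False m by (simp flip: exp_of_nat_mult)
      then show thesis by (rule that)
    qed
    have y1: "norm y < 1"
      using y z m power_less_one_iff[of "norm y" m] by (auto simp: norm_power)
    define A where "A = (1 / real m) *\<^sub>R (\<Sum>j<m. p (\<omega> ^ j * y))"
    have "A \<in> q ` \<bbbD>"
      unfolding A_def
    proof (rule convex_average[OF _ m])
      show "convex (q ` \<bbbD>)" using q by (simp add: convex_in_disk_def)
      show "p (\<omega> ^ j * y) \<in> q ` \<bbbD>" for j
        using norm\<omega>[of j y] y1 by (intro subsetD[OF sub] imageI) simp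
    qed
    moreover have "(\<lambda>n. (1 / real m) *\<^sub>R (\<Sum>j<m. c n * (\<omega> ^ j * y) ^ n)) sums A"
      unfolding A_def using norm\<omega> y1 by (intro sums_scaleR_right sums_sum sums) simp
    moreover have "(1 / real m) *\<^sub>R (\<Sum>j<m. c n * (\<omega> ^ j * y) ^ n)
        = (if m dvd n then c n * y ^ n else 0)" for n
    proof -
      have "(\<Sum>j<m. c n * (\<omega> ^ j * y) ^ n) = c n * y ^ n * (\<Sum>j<m. (\<omega> ^ j) ^ n)"
        by (simp add: sum_distrib_left power_mult_distrib mult_ac)
      then show ?thesis using m by (simp add: root_sum scaleR_conv_of_real)
    qed
    ultimately have "A \<in> q ` \<bbbD>" and "(\<lambda>n. if m dvd n then c n * y ^ n else 0) sums A" by simp_all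
    moreover have "strict_mono ((*) m)" using m by (auto simp: strict_mono_def)
    ultimately have "(\<lambda>k. if m dvd m * k then c (m * k) * y ^ (m * k) else 0) sums A"
      by (subst sums_mono_reindex[where f = "\<lambda>n. if m dvd n then c n * y ^ n else 0"]) auto
    then have "(\<lambda>k. c (m * k) * z ^ k) sums A" by (simp add: power_mult y)
    with \<open>A \<in> q ` \<bbbD>\<close> show ?thesis by (simp add: F_def sums_iff)
  qed
  have "F holomorphic_on \<bbbD>"
    by (rule power_series_holomorphic[where a = "\<lambda>k. c (m * k)"]) (use F in auto)
  moreover have "c 0 = p 0" using sums[of 0] by (simp add: powser_sums_zero_iff)
  then have "F 0 = q 0" using \<open>p 0 = q 0\<close> by (simp add: F_def)
  ultimately have "norm (deriv F 0) \<le> norm (deriv q 0)"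
    using q F by (intro univalent_subordination(2)) (auto simp: convex_in_disk_def)
  moreover have "deriv F 0 = c (m * 1)"
    using F by (intro power_series_deriv_0[of 1 "\<lambda>k. c (m * k)"]) auto
  ultimately show ?thesis by simp
qed

section \<open>Logarithmic coefficients and the radius\<close>

text \<open>With L = log (f(z) / z), the function z f'(z) / f(z) = 1 + z L'(z) has
  \<open>m\<close>-th coefficient \<open>2 * m * log_coeff f m\<close>. Rogosinski bounds it by
  \<open>norm (deriv \<psi> 0)\<close>, which is half of
  \<open>norm (deriv \<phi> 0)\<close>.\<close>

lemma class_C_log_coeff_bound:
  assumes \<phi>: "convex_in_disk \<phi>" "\<phi> 0 = 1" "\<And>z. norm z < 1 \<Longrightarrow> Re (\<phi> z) > 0"
    and \<psi>: "convex_in_disk \<psi>" "\<psi> 0 = 1" "\<And>z. norm z < 1 \<Longrightarrow> \<psi> z \<noteq> 0"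
    and eq: "\<And>z. norm z < 1 \<Longrightarrow> \<psi> z + z * deriv \<psi> z / \<psi> z = \<phi> z"
    and f: "f \<in> class_C \<phi>" and m: "m \<ge> 1"
  shows "norm (log_coeff f m) \<le> norm (deriv \<phi> 0) / (4 * real m)"
proof -
  have hol\<psi>: "\<psi> holomorphic_on \<bbbD>" and inj\<psi>: "inj_on \<psi> \<bbbD>"
    using \<psi>(1) by (auto simp: convex_in_disk_def)
  obtain g where g: "g holomorphic_on \<bbbD>" "g 0 = 1" "\<And>z. norm z < 1 \<Longrightarrow> g z \<noteq> 0"
    "\<And>z. norm z < 1 \<Longrightarrow> f z = z * g z" "(\<lambda>z. deriv f z / g z) ` \<bbbD> \<subseteq> \<psi> ` \<bbbD>"
    using class_C_imp_quotient_subordinate[OF \<phi> hol\<psi> inj\<psi> \<psi>(2) eq f] by blast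
  have "simply_connected \<bbbD>" by (simp add: convex_imp_simply_connected)
  then obtain L0 where L0: "L0 holomorphic_on \<bbbD>" "\<And>z. z \<in> \<bbbD> \<Longrightarrow> g z = exp (L0 z)"
    using g by (auto simp: simply_connected_eq_holomorphic_log)
  \<comment> \<open>As \<open>g 0 = 1\<close>, the constant \<open>L0 0\<close> has exponential 1;
    subtracting it selects the branch that vanishes at 0.\<close>
  define L where "L = (\<lambda>z. L0 z - L0 0)"
  have L: "L holomorphic_on \<bbbD>" "L 0 = 0" and gL: "\<And>z. norm z < 1 \<Longrightarrow> g z = exp (L z)"
    using L0 g(2) unfolding L_def by (auto intro!: holomorphic_intros simp: exp_diff)
  define l where "l = (\<lambda>n. (deriv ^^ n) L 0 / fact n)"
  have Lsums: "(\<lambda>n. l n * z ^ n) sums L z" if "norm z < 1" for z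
    using holomorphic_power_series[OF L(1), of z] that by (simp add: l_def)
  have l0: "l 0 = 0" using L by (simp add: l_def)
  have "is_log_coeffs f (\<lambda>n. l n / 2)"
    unfolding is_log_coeffs_def using L l0 Lsums gL g(4) by (intro conjI exI[of _ L]) auto
  then have coeff: "log_coeff f m = l m / 2" by (simp add: log_coeff_eqI)
  define c where "c = (\<lambda>n. if n = 0 then 1 else of_nat n * l n)"
  have csums: "(\<lambda>n. c n * z ^ n) sums (deriv f z / g z)" if z: "norm z < 1" for z
  proof -
    have DL: "(L has_field_derivative deriv L z) (at z)"
      using z by (intro holomorphic_derivI[OF L(1)]) auto
    have "((\<lambda>z. z * exp (L z)) has_field_derivative g z + z * (g z * deriv L z)) (at z)"
      by (rule derivative_eq_intros DL refl)+ (use z in \<open>simp add: gL algebra_simps\<close>)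
    then have "(f has_field_derivative g z + z * (g z * deriv L z)) (at z)"
      by (rule has_field_derivative_transform_within_open[of _ _ _ \<bbbD>]) (use z g gL in auto)
    then have quot: "deriv f z / g z = z * deriv L z + 1"
      using g(3)[OF z] by (simp add: DERIV_imp_deriv field_simps)
    have "((\<lambda>z. \<Sum>n. l n * z ^ n) has_field_derivative (\<Sum>n. diffs l n * z ^ n)) (at z)"
      using Lsums z by (intro termdiffs_strong'[of 1]) (auto intro: sums_summable)
    then have "(L has_field_derivative (\<Sum>n. diffs l n * z ^ n)) (at z)"
      by (rule has_field_derivative_transform_within_open[of _ _ _ \<bbbD>])
        (use Lsums z in \<open>auto simp: sums_iff\<close>)
    moreover have "summable (\<lambda>n. diffs l n * z ^ n)"
      using Lsums z by (intro termdiff_converges[of z 1]) (auto intro: sums_summable)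
    ultimately have "(\<lambda>n. diffs l n * z ^ n) sums deriv L z"
      by (simp add: DERIV_imp_deriv sums_iff)
    then have "(\<lambda>n. z * (diffs l n * z ^ n)) sums (z * deriv L z)" by (rule sums_mult)
    then have "(\<lambda>n. c (Suc n) * z ^ Suc n) sums (z * deriv L z)"
      by (simp add: c_def diffs_def mult_ac)
    from sums_Suc[OF this] show ?thesis by (simp add: quot c_def)
  qed
  have "deriv f 0 / g 0 = \<psi> 0"
    using f g(2) \<psi>(2) by (simp add: class_C_def class_A_def)
  from Rogosinski[OF \<psi>(1) this g(5) csums m]
  have "norm (c m) \<le> norm (deriv \<psi> 0)" .
  moreover have "deriv \<phi> 0 = 2 * deriv \<psi> 0"
  proof (rule DERIV_imp_deriv)
    have D1: "(\<psi> has_field_derivative deriv \<psi> 0) (at 0)"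
      by (rule holomorphic_derivI[OF hol\<psi>]) auto
    have "(\<lambda>z. deriv \<psi> z / \<psi> z) holomorphic_on \<bbbD>"
      using \<psi>(3) by (intro holomorphic_intros hol\<psi> holomorphic_deriv[OF hol\<psi>]) auto
    from holomorphic_derivI[OF this open_ball, of 0]
    obtain d where D2: "((\<lambda>z. deriv \<psi> z / \<psi> z) has_field_derivative d) (at 0)" by auto
    \<comment> \<open>In the derivative at 0 the term with \<open>d\<close> carries the factor 0, so
      the second summand contributes only
      \<open>deriv \<psi> 0 / \<psi> 0 = deriv \<psi> 0\<close>.\<close>
    have "((\<lambda>z. \<psi> z + z * (deriv \<psi> z / \<psi> z)) has_field_derivative 2 * deriv \<psi> 0) (at 0)"
      by (rule derivative_eq_intros D1 D2 refl)+ (simp add: \<psi>(2))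
    then show "(\<phi> has_field_derivative 2 * deriv \<psi> 0) (at 0)"
      by (rule has_field_derivative_transform_within_open[of _ _ _ \<bbbD>]) (use eq in auto)
  qed
  ultimately show ?thesis
    using m by (simp add: coeff c_def norm_mult norm_divide field_simps)
qed

lemma sums_harmonic_powers:
  assumes "0 \<le> r" "r < 1"
  shows "(\<lambda>m. r ^ Suc m / real (Suc m)) sums - ln (1 - r)"
proof -
  have "(\<lambda>n. - (r ^ n) / real n) sums ln (1 - r)"
    using ln_series'[of "-r"] assms by simp
  from sums_minus[OF this] have "(\<lambda>n. r ^ n / real n) sums - ln (1 - r)" by simp
  \<comment> \<open>The term at index 0 is a division by zero, hence 0, so the shift leaves the sum
    unchanged.\<close>
  then show ?thesis by (subst sums_Suc_iff) simp
qed

theorem theorem3p3: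
  fixes \<phi> \<psi> :: "complex \<Rightarrow> complex" and B :: "nat \<Rightarrow> complex" and R :: real
  assumes "ma_minda \<phi>" and "convex_in_disk \<phi>"
    and "B 0 = 1" and "\<forall>z\<in>\<bbbD>. (\<lambda>n. B n * z ^ n) sums \<phi> z"
    and "\<psi> 0 = 1" and "convex_in_disk \<psi>"
    and "\<forall>z\<in>\<bbbD>. \<psi> z \<noteq> 0 \<and> \<psi> z + z * deriv \<psi> z / \<psi> z = \<phi> z"
    and "R = 1 - 1 / exp (2 / cmod (B 1))"
  shows "(\<forall>f \<in> class_C \<phi>. \<forall>r. 0 \<le> r \<and> r \<le> R \<longrightarrow>
            summable (\<lambda>m. cmod (log_coeff f (Suc m)) * r ^ Suc m) \<and>
            2 * (\<Sum>m. cmod (log_coeff f (Suc m)) * r ^ Suc m) \<le> 1)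
       \<and> (\<forall>f \<in> class_A.
            (\<forall>z\<in>\<bbbD>. deriv f z \<noteq> 0 \<and> 1 + z * deriv (deriv f) z / deriv f z = \<phi> z) \<and>
            (\<forall>m\<ge>1. cmod (log_coeff f m) = cmod (B 1) / (4 * real m)) \<longrightarrow>
            f \<in> class_C \<phi> \<and>
            (\<forall>r. R < r \<and> r < 1 \<longrightarrow>
               summable (\<lambda>m. cmod (log_coeff f (Suc m)) * r ^ Suc m) \<and>
               2 * (\<Sum>m. cmod (log_coeff f (Suc m)) * r ^ Suc m) > 1))"
proof -
  define b where "b = cmod (B 1)"
  have \<phi>: "\<phi> 0 = 1" "\<And>z. norm z < 1 \<Longrightarrow> Re (\<phi> z) > 0" "deriv \<phi> 0 \<noteq> 0"
    using assms(1) by (auto simp: ma_minda_def)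
  have \<psi>: "\<And>z. norm z < 1 \<Longrightarrow> \<psi> z \<noteq> 0"
    "\<And>z. norm z < 1 \<Longrightarrow> \<psi> z + z * deriv \<psi> z / \<psi> z = \<phi> z"
    using assms(7) by auto
  have B1: "deriv \<phi> 0 = B 1"
    using assms(4) by (intro power_series_deriv_0[of 1]) auto
  have b: "b > 0" using \<phi>(3) B1 by (simp add: b_def)
  have R: "1 - R = exp (- (2 / b))" by (simp add: assms(8) b_def exp_minus field_simps)
  then have R1: "R < 1" using exp_gt_zero[of "- (2 / b)"] by linarith
  have major: "(\<lambda>m. b / (4 * real (Suc m)) * r ^ Suc m) sums (b / 4 * - ln (1 - r))"
    if "0 \<le> r" "r < 1" for r
    using sums_mult[OF sums_harmonic_powers[OF that], of "b / 4"] by (simp add: mult_ac)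
  \<comment> \<open>\<open>R\<close> is where the doubled majorant
    \<open>- (b / 2) * ln (1 - r)\<close> reaches 1; this equivalence serves both the bound and its
    sharpness.\<close>
  have R_iff: "r \<le> R \<longleftrightarrow> 2 * (b / 4 * - ln (1 - r)) \<le> 1" if "r < 1" for r
  proof -
    have "r \<le> R \<longleftrightarrow> exp (- (2 / b)) \<le> 1 - r" using R by linarith
    also have "\<dots> \<longleftrightarrow> - (2 / b) \<le> ln (1 - r)" using that by (subst ln_ge_iff) auto
    also have "\<dots> \<longleftrightarrow> 2 * (b / 4 * - ln (1 - r)) \<le> 1" using b by (simp add: field_simps)
    finally show ?thesis .
  qed
  show ?thesis
  proof (intro conjI ballI allI impI)
    fix f r assume f: "f \<in> class_C \<phi>" and r: "0 \<le> r \<and> r \<le> R"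
    have le: "cmod (log_coeff f (Suc m)) * r ^ Suc m \<le> b / (4 * real (Suc m)) * r ^ Suc m" for m
      using class_C_log_coeff_bound[OF assms(2) \<phi>(1,2) assms(6,5) \<psi> f, of "Suc m"] r
      by (intro mult_right_mono) (auto simp: B1 b_def)
    have r1: "0 \<le> r" "r < 1" using r R1 by auto
    show sm: "summable (\<lambda>m. cmod (log_coeff f (Suc m)) * r ^ Suc m)"
      using sums_summable[OF major[OF r1]] le r
      by (rule_tac summable_comparison_test') (auto simp: abs_mult)
    have "(\<Sum>m. cmod (log_coeff f (Suc m)) * r ^ Suc m) \<le> b / 4 * - ln (1 - r)"
      using suminf_le[OF le sm sums_summable[OF major[OF r1]]] sums_unique[OF major[OF r1]] by simp
    then show "2 * (\<Sum>m. cmod (log_coeff f (Suc m)) * r ^ Suc m) \<le> 1"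
      using R_iff[of r] r r1 by linarith
  next
    fix f assume f: "f \<in> class_A"
      and h: "(\<forall>z\<in>\<bbbD>. deriv f z \<noteq> 0 \<and> 1 + z * deriv (deriv f) z / deriv f z = \<phi> z) \<and>
        (\<forall>m\<ge>1. cmod (log_coeff f m) = cmod (B 1) / (4 * real m))"
    show "f \<in> class_C \<phi>"
      unfolding class_C_def subordinate_def using f h
      by (auto intro!: exI[of _ "\<lambda>z. z"] holomorphic_intros)
    fix r assume r: "R < r \<and> r < 1"
    have "R \<ge> 0" using R b by (simp add: algebra_simps) (smt (verit) exp_le_one_iff divide_pos_pos)
    then have r1: "0 \<le> r" "r < 1" using r by auto
    \<comment> \<open>For an extremal \<open>f\<close> the series coincides with the majorant, so
      \<open>R_iff\<close> read in the other direction gives a value above 1.\<close>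
    have "(\<lambda>m. cmod (log_coeff f (Suc m)) * r ^ Suc m) sums (b / 4 * - ln (1 - r))"
      using major[OF r1] h by (simp add: b_def)
    then show "summable (\<lambda>m. cmod (log_coeff f (Suc m)) * r ^ Suc m)"
      "2 * (\<Sum>m. cmod (log_coeff f (Suc m)) * r ^ Suc m) > 1"
      using R_iff[of r] r by (auto simp: sums_iff)
  qed
qed

end
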